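(* Let $(\Phi_{-N},\dots,\Phi_N)\in\mathbb R^{2N+1}$ be a given conjugate external force, and suppose that there exist $r_L$ and $r_U$ such that $$\frac{\tilde r_2}{2}<r_L<r_U,$$ $$\phi''(r_U)+21\,\phi''(2r_L)>0,$$ $$\phi'(r_L)+6\phi'(2r_L)-4\phi'(2r_U)<\Phi_j<\phi'(r_U)+6\phi'(2r_U)-4\phi'(2r_L),\qquad j=-N,\dots,N.$$ Let $\Omega:=(r_L,r_U)^{2N+1}$. Then for every $\mathbf r^{p}\in\Omega$ there is a unique $\mathbf r^{p+1}\in\Omega$ such that $$\psi^{QCE}_j(\mathbf r^{p+1})+\psi^{G}_j(\mathbf r^{p})+\Phi_j=0,\qquad j=-N,\dots,N.$$ Moreover, the induced mapping $\Omega\to\Omega$, $\mathbf r^p\mapsto\mathbf r^{p+1}$, is a contraction: if $\mathbf r^p\mapsto\mathbf r^{p+1}$ and $\mathbf s^p\mapsto\mathbf s^{p+1}$ under this mapping, then $$\|\mathbf r^{p+1}-\mathbf s^{p+1}\|_\infty\le\frac{16\,|\phi''(2r_L)|}{\phi''(r_U)-5\,|\phi''(2r_L)|}\,\|\mathbf r^p-\mathbf s^p\|_\infty,$$ where $$\frac{16\,|\phi''(2r_L)|}{\phi''(r_U)-5\,|\phi''(2r_L)|}<1.$$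
   Context: **Potential.** $\phi\in C^3((0,\infty))$ is a real-valued pair potential. Let $a_0>0$ be the minimizer of $r\mapsto\phi(r)+\phi(2r)$ and let $W(D):=a_0^{-1}\big(\phi(Da_0)+\phi(2Da_0)\big)$ for $D>0$. It is assumed that there exist $\tilde r_1,\tilde r_2,\widetilde D$ such that: - $\phi''(r)>0$ for $0<r<\tilde r_1$ and $\phi''(r)<0$ for $r>\tilde r_1$; - $\phi'''(r)<0$ for $0<r<\tilde r_2$ and $\phi'''(r)>0$ for $r>\tilde r_2$; - $W'(D)<0$ for $0<D<1$ and $W'(D)>0$ for $D>1$; - $W''(D)>0$ for $0<D<\widetilde D$ and $W''(D)<0$ for $D>\widetilde D$; - $0<a_0<\tilde r_1<\tilde r_2<2a_0$ and $1<\widetilde D$. **Chain.** Let $K\ge1$ and $N\ge K+1$ be integers. The representative atoms are indexed by $j=-N,\dots,N+1$. Those with $-K+1\le j\le K$ are atomistic; the others ($-N\le j\le -K$ and $K+1\le j\le N+1$) are continuum. The element between representative atoms $j$ and $j+1$, for $j=-N,\dots,N$, contains $\nu_j\ge1$ (an integer) atomic spacings, all equal to $r_j>0$. It is assumed that $\nu_j=1$ for $j=-K-1,\dots,K+1$. Write $\mathbf r=(r_{-N},\dots,r_N)\in(0,\infty)^{2N+1}$, and let $\|\cdot\|_\infty$ be the maximum norm on $\mathbb R^{2N+1}$. **Energy-based quasicontinuum approximation (QCE).** For the atomistic atoms, $-K+1\le j\le K$, set $$\mathcal E^a_j(\mathbf r)=\tfrac12\big[\phi(r_j)+\phi(r_j+r_{j+1})+\phi(r_{j-1})+\phi(r_{j-1}+r_{j-2})\big].$$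 For the continuum atoms set $$\mathcal E^L_j(\mathbf r)=\tfrac12\big[\nu_j(\phi(r_j)+\phi(2r_j))+\nu_{j-1}(\phi(r_{j-1})+\phi(2r_{j-1}))\big],$$ where terms with element index less than $-N$ or greater than $N$ are taken to be zero. Then $$\mathcal E^{QCE}(\mathbf r)=\sum_{j=-N}^{-K}\mathcal E^L_j(\mathbf r)+\sum_{j=-K+1}^{K}\mathcal E^a_j(\mathbf r)+\sum_{j=K+1}^{N+1}\mathcal E^L_j(\mathbf r),\qquad \psi^{QCE}_j(\mathbf r):=-\nu_j^{-1}\frac{\partial\mathcal E^{QCE}}{\partial r_j}(\mathbf r),\quad j=-N,\dots,N.$$ **Force-based quasicontinuum approximation (QCF).** With $I_j:=2\phi'(2r_j)-\phi'(r_j+r_{j-1})-\phi'(r_j+r_{j+1})$, the QCF conjugate forces are $$-\psi^{QCF}_j(\mathbf r)=\begin{cases}\phi'(r_j)+2\phi'(2r_j), & -N\le j\le -K,\\ \phi'(r_j)+\phi'(r_j+r_{j-1})+\phi'(r_j+r_{j+1})+I_{-K}, & -K+1\le j\le K,\\ \phi'(r_j)+2\phi'(2r_j)+I_{-K}-I_K, & K+1\le j\le N.\end{cases}$$ **Correction force.** $\psi^G_j(\mathbf r):=\psi^{QCF}_j(\mathbf r)-\psi^{QCE}_j(\mathbf r)$ for $j=-N,\dots,N$. *)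

theory Defs
  imports "HOL-Analysis.Analysis"
begin

section \<open>The pair potential\<close>

text \<open>Class \<open>C\<^sup>k\<close> on a set \<open>S\<close>, meant for open \<open>S\<close> only: \<^const>\<open>deriv\<close> is the two-sided derivative.\<close>

definition Ck_on_open :: "nat \<Rightarrow> (real \<Rightarrow> real) \<Rightarrow> real set \<Rightarrow> bool" where
  "Ck_on_open k f S \<longleftrightarrow>
     (\<forall>i<k. (deriv ^^ i) f differentiable_on S) \<and> continuous_on S ((deriv ^^ k) f)"

definition W :: "(real \<Rightarrow> real) \<Rightarrow> real \<Rightarrow> real \<Rightarrow> real" where
  "W \<phi> a0 D = (\<phi> (D * a0) + \<phi> (2 * D * a0)) / a0"

text \<open>The potential is a total function, but only its values on \<open>(0, \<infinity>)\<close> are constrained.\<close>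

definition qc_potential ::
    "(real \<Rightarrow> real) \<Rightarrow> real \<Rightarrow> real \<Rightarrow> real \<Rightarrow> real \<Rightarrow> bool" where
  "qc_potential \<phi> a0 rt1 rt2 Dt \<longleftrightarrow>
     Ck_on_open 3 \<phi> {0<..} \<and>
     is_arg_min (\<lambda>r. \<phi> r + \<phi> (2 * r)) (\<lambda>r. 0 < r) a0 \<and>
     (\<forall>r. 0 < r \<and> r < rt1 \<longrightarrow> (deriv ^^ 2) \<phi> r > 0) \<and>
     (\<forall>r. r > rt1 \<longrightarrow> (deriv ^^ 2) \<phi> r < 0) \<and>
     (\<forall>r. 0 < r \<and> r < rt2 \<longrightarrow> (deriv ^^ 3) \<phi> r < 0) \<and>
     (\<forall>r. r > rt2 \<longrightarrow> (deriv ^^ 3) \<phi> r > 0) \<and>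
     (\<forall>D. 0 < D \<and> D < 1 \<longrightarrow> deriv (W \<phi> a0) D < 0) \<and>
     (\<forall>D. D > 1 \<longrightarrow> deriv (W \<phi> a0) D > 0) \<and>
     (\<forall>D. 0 < D \<and> D < Dt \<longrightarrow> (deriv ^^ 2) (W \<phi> a0) D > 0) \<and>
     (\<forall>D. D > Dt \<longrightarrow> (deriv ^^ 2) (W \<phi> a0) D < 0) \<and>
     0 < a0 \<and> a0 < rt1 \<and> rt1 < rt2 \<and> rt2 < 2 * a0 \<and> 1 < Dt"

section \<open>The chain\<close>

text \<open>
  Vectors of \<open>\<real>\<^bsup>2N+1\<^esup>\<close> are functions on \<^typ>\<open>int\<close> of which only the entries with index in
  \<open>{-N..N}\<close> matter; \<open>\<nu>\<close> is represented in the same way.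
\<close>

definition qc_chain :: "int \<Rightarrow> int \<Rightarrow> (int \<Rightarrow> nat) \<Rightarrow> bool" where
  "qc_chain K N \<nu> \<longleftrightarrow>
     K \<ge> 1 \<and> N \<ge> K + 1 \<and> (\<forall>j\<in>{-N..N}. \<nu> j \<ge> 1) \<and> (\<forall>j\<in>{-K-1..K+1}. \<nu> j = 1)"

definition max_norm :: "int \<Rightarrow> (int \<Rightarrow> real) \<Rightarrow> real" where
  "max_norm N x = Max ((\<lambda>j. \<bar>x j\<bar>) ` {-N..N})"

text \<open>
  The open cube \<open>(rL, rU)\<^bsup>2N+1\<^esup>\<close>. Extensionality (\<^const>\<open>PiE\<close>) fixes the irrelevant entries outside
  \<open>{-N..N}\<close>, so that equality of elements is equality of vectors.
\<close>

definition cube :: "int \<Rightarrow> real \<Rightarrow> real \<Rightarrow> (int \<Rightarrow> real) set" where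
  "cube N rL rU = PiE {-N..N} (\<lambda>_. {rL<..<rU})"

section \<open>The energy-based quasicontinuum approximation\<close>

definition E_atomistic :: "(real \<Rightarrow> real) \<Rightarrow> (int \<Rightarrow> real) \<Rightarrow> int \<Rightarrow> real" where
  "E_atomistic \<phi> r j =
     (\<phi> (r j) + \<phi> (r j + r (j+1)) + \<phi> (r (j-1)) + \<phi> (r (j-1) + r (j-2))) / 2"

definition element_energy ::
    "(real \<Rightarrow> real) \<Rightarrow> int \<Rightarrow> (int \<Rightarrow> nat) \<Rightarrow> (int \<Rightarrow> real) \<Rightarrow> int \<Rightarrow> real" where
  "element_energy \<phi> N \<nu> r j =
     (if j \<in> {-N..N} then real (\<nu> j) * (\<phi> (r j) + \<phi> (2 * r j)) else 0)"

definition E_continuum ::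
    "(real \<Rightarrow> real) \<Rightarrow> int \<Rightarrow> (int \<Rightarrow> nat) \<Rightarrow> (int \<Rightarrow> real) \<Rightarrow> int \<Rightarrow> real" where
  "E_continuum \<phi> N \<nu> r j = (element_energy \<phi> N \<nu> r j + element_energy \<phi> N \<nu> r (j-1)) / 2"

definition E_QCE ::
    "(real \<Rightarrow> real) \<Rightarrow> int \<Rightarrow> int \<Rightarrow> (int \<Rightarrow> nat) \<Rightarrow> (int \<Rightarrow> real) \<Rightarrow> real" where
  "E_QCE \<phi> K N \<nu> r =
     (\<Sum>j\<in>{-N..-K}. E_continuum \<phi> N \<nu> r j)
     + (\<Sum>j\<in>{-K+1..K}. E_atomistic \<phi> r j)
     + (\<Sum>j\<in>{K+1..N+1}. E_continuum \<phi> N \<nu> r j)"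

definition partial_deriv :: "((int \<Rightarrow> real) \<Rightarrow> real) \<Rightarrow> int \<Rightarrow> (int \<Rightarrow> real) \<Rightarrow> real" where
  "partial_deriv F j r = deriv (\<lambda>x. F (r(j := x))) (r j)"

definition psi_QCE ::
    "(real \<Rightarrow> real) \<Rightarrow> int \<Rightarrow> int \<Rightarrow> (int \<Rightarrow> nat) \<Rightarrow> (int \<Rightarrow> real) \<Rightarrow> int \<Rightarrow> real" where
  "psi_QCE \<phi> K N \<nu> r j = - (partial_deriv (E_QCE \<phi> K N \<nu>) j r / real (\<nu> j))"

section \<open>The force-based quasicontinuum approximation\<close>

definition interface_term :: "(real \<Rightarrow> real) \<Rightarrow> (int \<Rightarrow> real) \<Rightarrow> int \<Rightarrow> real" where
  "interface_term \<phi> r j =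
     2 * deriv \<phi> (2 * r j) - deriv \<phi> (r j + r (j-1)) - deriv \<phi> (r j + r (j+1))"

text \<open>Meaningful for indices in \<open>{-N..N}\<close> only.\<close>

definition psi_QCF :: "(real \<Rightarrow> real) \<Rightarrow> int \<Rightarrow> (int \<Rightarrow> real) \<Rightarrow> int \<Rightarrow> real" where
  "psi_QCF \<phi> K r j =
     - (if j \<le> -K then
          deriv \<phi> (r j) + 2 * deriv \<phi> (2 * r j)
        else if j \<le> K then
          deriv \<phi> (r j) + deriv \<phi> (r j + r (j-1)) + deriv \<phi> (r j + r (j+1))
          + interface_term \<phi> r (-K)
        else
          deriv \<phi> (r j) + 2 * deriv \<phi> (2 * r j)
          + interface_term \<phi> r (-K) - interface_term \<phi> r K)"

definition psi_G ::
    "(real \<Rightarrow> real) \<Rightarrow> int \<Rightarrow> int \<Rightarrow> (int \<Rightarrow> nat) \<Rightarrow> (int \<Rightarrow> real) \<Rightarrow> int \<Rightarrow> real" where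
  "psi_G \<phi> K N \<nu> r j = psi_QCF \<phi> K r j - psi_QCE \<phi> K N \<nu> r j"

text \<open>One step \<open>r\<^sup>p \<mapsto> r\<^bsup>p+1\<^esup>\<close> of the iteration with the correction force lagged, as a relation.\<close>

definition ghost_force_step ::
    "(real \<Rightarrow> real) \<Rightarrow> int \<Rightarrow> int \<Rightarrow> (int \<Rightarrow> nat) \<Rightarrow> (int \<Rightarrow> real) \<Rightarrow>
     (int \<Rightarrow> real) \<Rightarrow> (int \<Rightarrow> real) \<Rightarrow> bool" where
  "ghost_force_step \<phi> K N \<nu> \<Phi> r r' \<longleftrightarrow>
     (\<forall>j\<in>{-N..N}. psi_QCE \<phi> K N \<nu> r' j + psi_G \<phi> K N \<nu> r j + \<Phi> j = 0)"

end

theory Submission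
  imports Defs
begin

text \<open>
  Up to sign, the conjugate force of element \<open>j\<close> is the nearest-neighbour term \<open>\<phi>'(r\<^sub>j)\<close> plus a linear
  combination of second-neighbour forces, namely of \<open>\<phi>'(2 r\<^sub>i)\<close> and \<open>\<phi>'(r\<^sub>i + r\<^bsub>i+1\<^esub>)\<close>. This holds for QCE and
  for QCF, and in the correction force the nearest-neighbour terms cancel. On \<open>(r\<^sub>L, r\<^sub>U)\<close> the slope of
  \<open>\<phi>'\<close> is at least \<open>A = \<phi>''(r\<^sub>U)\<close>. All second-neighbour distances lie in \<open>[2 r\<^sub>L, 2 r\<^sub>U]\<close>, beyond both \<open>rt1\<close>
  and \<open>rt2\<close>, where \<open>\<phi>'\<close> decreases with slope at most \<open>b = \<bar>\<phi>''(2 r\<^sub>L)\<bar>\<close> in absolute value. What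
  remains is to count the coefficients of the linear combinations near the two interfaces.

  \<^item> Contraction: the QCE combination has coefficients of absolute sum at most \<open>5/2\<close>, the correction
    has at most \<open>8\<close>, and a difference of second-neighbour distances is at most twice the maximum
    norm. Evaluating the difference of two force balances at an element where \<open>\<bar>r'\<^sub>j - s'\<^sub>j\<bar>\<close> is largest
    gives \<open>(A - 5 b) \<parallel>r' - s'\<parallel> \<le> 16 b \<parallel>r - s\<parallel>\<close> (\<open>ghost_force_step_estimate\<close>). The choice \<open>r = s\<close> gives
    uniqueness, and \<open>A > 21 b\<close> makes the factor smaller than \<open>1\<close>.

  \<^item> Existence: for fixed \<open>r\<close> the equations for \<open>r'\<close> say that the QCE energy plus a linear term, the
    work of the correction and external forces, is stationary. A minimizer over the closed
    box exists by compactness. The coefficients of the combined second-neighbour forces add up to \<open>2\<close>,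
    with negative part at most \<open>4\<close>, so the bounds on the external force make this
    total energy increase outwards across every face (\<open>mixed_second_bounds\<close>). Hence the minimizer is
    interior and solves the equations (\<open>critical_point_in_open_box\<close>).
\<close>

section \<open>Critical points of energies on a box\<close>

text \<open>
  Tychonoff's theorem for the topology of the function type, which is a product over all indices: an
  extensional function is confined to a single point at each index outside \<open>I\<close>.
\<close>

lemma compact_box_PiE:
  fixes a b :: real
  shows "compact (PiE I (\<lambda>_. {a..b}) :: ('i \<Rightarrow> real) set)"
proof -
  let ?S = "\<lambda>i. if i \<in> I then {a..b} else {undefined}"
  have "PiE I (\<lambda>_. {a..b}) = PiE UNIV ?S"
    by (auto simp: PiE_def Pi_def extensional_def split: if_splits)
  moreover have "compactin (product_topology (\<lambda>_. euclidean) UNIV) (PiE UNIV ?S)"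
    by (subst compactin_PiE) auto
  ultimately show ?thesis
    by (simp add: euclidean_product_topology)
qed

text \<open>
  A minimizer over the closed box cannot lie on a face \<open>r\<^sub>j = a\<close> or \<open>r\<^sub>j = b\<close>, because the sign of the
  partial derivative there would allow a decrease of \<open>E\<close> by moving inwards. In the interior every
  partial derivative vanishes at a minimum.
\<close>

lemma critical_point_in_open_box:
  fixes E :: "('i \<Rightarrow> real) \<Rightarrow> real" and a b :: real
  assumes "a < b"
    and cont: "continuous_on (PiE I (\<lambda>_. {a..b})) E"
    and deriv: "\<And>r j. r \<in> PiE I (\<lambda>_. {a..b}) \<Longrightarrow> j \<in> I \<Longrightarrow>
                  ((\<lambda>x. E (r(j := x))) has_field_derivative D r j) (at (r j))"
    and lower: "\<And>r j. r \<in> PiE I (\<lambda>_. {a..b}) \<Longrightarrow> j \<in> I \<Longrightarrow> r j = a \<Longrightarrow> D r j < 0"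
    and upper: "\<And>r j. r \<in> PiE I (\<lambda>_. {a..b}) \<Longrightarrow> j \<in> I \<Longrightarrow> r j = b \<Longrightarrow> D r j > 0"
  shows "\<exists>r \<in> PiE I (\<lambda>_. {a<..<b}). \<forall>j\<in>I. D r j = 0"
proof -
  let ?box = "PiE I (\<lambda>_. {a..b})"
  have "?box \<noteq> {}"
    using \<open>a < b\<close> by (auto simp: PiE_eq_empty_iff)
  then obtain r where r: "r \<in> ?box" and min: "\<And>s. s \<in> ?box \<Longrightarrow> E r \<le> E s"
    using continuous_attains_inf[OF compact_box_PiE _ cont] by blast
  have "r j \<in> {a<..<b} \<and> D r j = 0" if j: "j \<in> I" for j
  proof -
    have rj: "r j \<in> {a..b}" using r j by auto
    have le: "E (r(j := r j)) \<le> E (r(j := x))" if "x \<in> {a..b}" for x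
      using min[of "r(j := x)"] r j that by (simp add: PiE_def extensional_def Pi_def)
    note d = deriv[OF r j]
    have not_neg: "\<not> D r j < 0" if "r j < b"
    proof
      assume "D r j < 0"
      from DERIV_neg_dec_right[OF d this] obtain e where e: "e > 0"
        "\<And>h. 0 < h \<Longrightarrow> h < e \<Longrightarrow> E (r(j := r j + h)) < E (r(j := r j))" by auto
      obtain h where "0 < h" "h < e" "h < b - r j"
        using field_lbound_gt_zero[OF \<open>e > 0\<close>, of "b - r j"] \<open>r j < b\<close> by auto
      then show False
        using e(2)[of h] le[of "r j + h"] rj by auto
    qed
    have not_pos: "\<not> D r j > 0" if "a < r j"
    proof
      assume "D r j > 0"
      from DERIV_pos_inc_left[OF d this] obtain e where e: "e > 0"
        "\<And>h. 0 < h \<Longrightarrow> h < e \<Longrightarrow> E (r(j := r j - h)) < E (r(j := r j))" by auto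
      obtain h where "0 < h" "h < e" "h < r j - a"
        using field_lbound_gt_zero[OF \<open>e > 0\<close>, of "r j - a"] \<open>a < r j\<close> by auto
      then show False
        using e(2)[of h] le[of "r j - h"] rj by auto
    qed
    show ?thesis
      using rj not_neg not_pos lower[OF r j] upper[OF r j] \<open>a < b\<close>
      by (cases "r j = a"; cases "r j = b") auto
  qed
  then show ?thesis using r by (intro bexI[of _ r]) (auto simp: PiE_def Pi_def)
qed

section \<open>Second-neighbour forces as linear functionals of the bond forces\<close>

text \<open>
  In the derivative of the QCE energy, \<open>\<phi>'(2 r\<^sub>j)\<close> and \<open>\<phi>'(r\<^sub>i + r\<^bsub>i+1\<^esub>)\<close> carry the weights below. The atoms
  \<open>j\<close> and \<open>j + 1\<close> at the ends of element \<open>j\<close> each contribute half of \<open>\<phi>(2 r\<^sub>j)\<close> if they are continuum. The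
  atoms \<open>i\<close> and \<open>i + 2\<close> at the ends of a second-neighbour bond each contribute half of
  \<open>\<phi>(r\<^sub>i + r\<^bsub>i+1\<^esub>)\<close> if they are atomistic. The weights \<open>1/2\<close> near \<open>\<plusminus>K\<close> are the source of the
  ghost forces.
\<close>

definition doubling_weight :: "int \<Rightarrow> int \<Rightarrow> real" where
  "doubling_weight K j = (of_bool (j < -K \<or> K < j) + of_bool (j \<le> -K \<or> K \<le> j)) / 2"

definition bond_weight :: "int \<Rightarrow> int \<Rightarrow> real" where
  "bond_weight K i = (of_bool (-K+1 \<le> i \<and> i \<le> K) + of_bool (-K-1 \<le> i \<and> i \<le> K-2)) / 2"

text \<open>
  In the functionals below, \<open>Q i\<close> stands for \<open>\<phi>'(2 r\<^sub>i)\<close> and \<open>B i\<close> for \<open>\<phi>'(r\<^sub>i + r\<^bsub>i+1\<^esub>)\<close>. Keeping \<open>Q\<close> and \<open>B\<close> as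
  free arguments lets one estimate serve both forces and differences of forces.
\<close>

definition qce_second :: "int \<Rightarrow> (int \<Rightarrow> real) \<Rightarrow> (int \<Rightarrow> real) \<Rightarrow> int \<Rightarrow> real" where
  "qce_second K Q B j =
     2 * doubling_weight K j * Q j + bond_weight K j * B j + bond_weight K (j-1) * B (j-1)"

definition interface_gap :: "(int \<Rightarrow> real) \<Rightarrow> (int \<Rightarrow> real) \<Rightarrow> int \<Rightarrow> real" where
  "interface_gap Q B i = 2 * Q i - B (i-1) - B i"

definition qcf_second :: "int \<Rightarrow> (int \<Rightarrow> real) \<Rightarrow> (int \<Rightarrow> real) \<Rightarrow> int \<Rightarrow> real" where
  "qcf_second K Q B j =
     (if j \<le> -K then 2 * Q j
      else if j \<le> K then B (j-1) + B j + interface_gap Q B (-K)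
      else 2 * Q j + interface_gap Q B (-K) - interface_gap Q B K)"

definition ghost_second :: "int \<Rightarrow> (int \<Rightarrow> real) \<Rightarrow> (int \<Rightarrow> real) \<Rightarrow> int \<Rightarrow> real" where
  "ghost_second K Q B j = qcf_second K Q B j - qce_second K Q B j"

lemmas second_defs = ghost_second_def qcf_second_def qce_second_def interface_gap_def
  doubling_weight_def bond_weight_def

lemma qce_second_diff:
  "qce_second K Q B j - qce_second K Q' B' j = qce_second K (\<lambda>i. Q i - Q' i) (\<lambda>i. B i - B' i) j"
  by (simp add: qce_second_def algebra_simps)

lemma ghost_second_diff:
  "ghost_second K Q B j - ghost_second K Q' B' j = ghost_second K (\<lambda>i. Q i - Q' i) (\<lambda>i. B i - B' i) j"
  by (simp add: ghost_second_def qce_second_def qcf_second_def interface_gap_def algebra_simps)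

text \<open>
  On each of these positions all weights are constants. The case \<open>K = 1\<close> is separate because then
  the first and the last inner atomistic elements coincide.
\<close>

lemma chain_position_cases:
  fixes j K :: int
  assumes "1 \<le> K"
  obtains (left) "j \<le> -K-2" | (left_outer) "j = -K-1" | (left_inner) "j = -K"
    | (left_atom) "j = -K+1" "j < K-1" | (single_atom) "j = 0" "K = 1"
    | (bulk_atom) "-K+1 < j" "j < K-1"
    | (right_atom) "j = K-1" "-K+1 < j" | (right_inner) "j = K"
    | (right_outer) "j = K+1" | (right) "K+2 \<le> j"
  using assms by linarith

text \<open>
  The extreme case is \<open>j = \<plusminus>(K + 1)\<close>, where the full continuum weight \<open>2\<close> meets half of the
  bond across the interface.
\<close>

lemma qce_second_abs_le:
  assumes "1 \<le> K" "K + 1 \<le> N" "j \<in> {-N..N}"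
    and Q: "\<And>i. i \<in> {-N..N} \<Longrightarrow> \<bar>Q i\<bar> \<le> X"
    and B: "\<And>i. i \<in> {-N..<N} \<Longrightarrow> \<bar>B i\<bar> \<le> X"
  shows "\<bar>qce_second K Q B j\<bar> \<le> 5/2 * X"
proof -
  have K: "1 \<le> K" "K + 1 \<le> N" by fact+
  have Q: "Q i \<in> {-X..X}" if "i \<in> {-N..N}" for i using Q[OF that] by auto
  have B: "B i \<in> {-X..X}" if "i \<in> {-N..<N}" for i using B[OF that] by auto
  have q: "Q j \<in> {-X..X}" using Q assms(3) by blast
  have b: "B j \<in> {-X..X}" if "j < N" using B[of j] assms(3) that by auto
  have b': "B (j-1) \<in> {-X..X}" if "-N < j" using B[of "j-1"] assms(3) that by auto
  have "qce_second K Q B j \<in> {-(5/2 * X)..5/2 * X}"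
  proof (cases rule: chain_position_cases[OF K(1), of j])
  qed (use K q b b' in \<open>simp_all add: second_defs\<close>)
  then show ?thesis by auto
qed

text \<open>
  The extreme case is \<open>K + 2 \<le> j\<close>: the QCE part cancels the continuum term, and each of the two
  interface gaps contributes \<open>2 + 1 + 1\<close>. For \<open>j = K + 1\<close> part of the second gap is cancelled.
\<close>

lemma ghost_second_abs_le:
  assumes "1 \<le> K" "K + 1 \<le> N" "j \<in> {-N..N}"
    and Q: "\<And>i. i \<in> {-N..N} \<Longrightarrow> \<bar>Q i\<bar> \<le> X"
    and B: "\<And>i. i \<in> {-N..<N} \<Longrightarrow> \<bar>B i\<bar> \<le> X"
  shows "\<bar>ghost_second K Q B j\<bar> \<le> 8 * X"
proof -
  have K: "1 \<le> K" "K + 1 \<le> N" by fact+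
  have Q: "Q i \<in> {-X..X}" if "i \<in> {-N..N}" for i using Q[OF that] by auto
  have B: "B i \<in> {-X..X}" if "i \<in> {-N..<N}" for i using B[OF that] by auto
  have q: "Q j \<in> {-X..X}" using Q assms(3) by blast
  have b: "B j \<in> {-X..X}" if "j < N" using B[of j] assms(3) that by auto
  have b': "B (j-1) \<in> {-X..X}" if "-N < j" using B[of "j-1"] assms(3) that by auto
  have i: "Q (-K) \<in> {-X..X}" "Q K \<in> {-X..X}" "B (-K-1) \<in> {-X..X}" "B (-K) \<in> {-X..X}"
     "B (K-1) \<in> {-X..X}" "B K \<in> {-X..X}"
    using K Q B by simp_all
  show ?thesis
  proof (cases rule: chain_position_cases[OF K(1), of j])
  qed (use K q b b' i in \<open>simp_all add: second_defs abs_le_iff\<close>)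
qed

text \<open>
  The coefficients of the two QCE parts cancel in total, and those of QCF sum to \<open>2\<close>. The negative
  ones sum to at most \<open>4\<close> in absolute value, attained to the right of the second interface. Hence
  the positive coefficients sum to at most \<open>6\<close>. Both vectors may vary independently because the
  correction is lagged.
\<close>

lemma mixed_second_bounds:
  assumes "1 \<le> K" "K + 1 \<le> N" "j \<in> {-N..N}"
    and Q: "\<And>i. i \<in> {-N..N} \<Longrightarrow> Q i \<in> {m..M}"
    and B: "\<And>i. i \<in> {-N..<N} \<Longrightarrow> B i \<in> {m..M}"
    and Q': "\<And>i. i \<in> {-N..N} \<Longrightarrow> Q' i \<in> {m..M}"
    and B': "\<And>i. i \<in> {-N..<N} \<Longrightarrow> B' i \<in> {m..M}"
  shows "qce_second K Q' B' j + ghost_second K Q B j \<in> {6 * m - 4 * M..6 * M - 4 * m}"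
proof -
  have K: "1 \<le> K" "K + 1 \<le> N" by fact+
  have q: "Q j \<in> {m..M}" "Q' j \<in> {m..M}" using Q Q' assms(3) by blast+
  have b: "B j \<in> {m..M}" "B' j \<in> {m..M}" if "j < N" 
    using B[of j] B'[of j] assms(3) that by auto
  have b': "B (j-1) \<in> {m..M}" "B' (j-1) \<in> {m..M}" if "-N < j" 
    using B[of "j-1"] B'[of "j-1"] assms(3) that by auto
  have i: "Q (-K) \<in> {m..M}" "Q K \<in> {m..M}" "B (-K-1) \<in> {m..M}" "B (-K) \<in> {m..M}"
     "B (K-1) \<in> {m..M}" "B K \<in> {m..M}"
    using K Q B by simp_all
  show ?thesis
  proof (cases rule: chain_position_cases[OF K(1), of j])
  qed (use K q b b' i in \<open>simp_all add: second_defs\<close>)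
qed

section \<open>Conjugate forces of the two approximations\<close>

definition doubling_force :: "(real \<Rightarrow> real) \<Rightarrow> (int \<Rightarrow> real) \<Rightarrow> int \<Rightarrow> real" where
  "doubling_force \<phi> r i = deriv \<phi> (2 * r i)"

definition bond_force :: "(real \<Rightarrow> real) \<Rightarrow> (int \<Rightarrow> real) \<Rightarrow> int \<Rightarrow> real" where
  "bond_force \<phi> r i = deriv \<phi> (r i + r (i+1))"

lemma psi_QCF_eq:
  "psi_QCF \<phi> K r j = - (deriv \<phi> (r j) + qcf_second K (doubling_force \<phi> r) (bond_force \<phi> r) j)"
  by (simp add: psi_QCF_def qcf_second_def interface_gap_def interface_term_def
      doubling_force_def bond_force_def add.commute)

text \<open>
  Differentiating each site energy separately produces sums of indicator terms, which collapse to
  the weights \<open>doubling_weight\<close> and \<open>bond_weight\<close> once the position of \<open>k\<close> is known. The factor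
  \<open>\<nu>\<^sub>k\<close> can be pulled out since \<open>\<nu>\<^sub>k = 1\<close> for every \<open>k\<close> that touches an atomistic bond.
\<close>

lemma E_QCE_has_partial_derivative:
  assumes chain: "qc_chain K N \<nu>" and k: "k \<in> {-N..N}"
    and pos: "\<And>i. i \<in> {-N..N} \<Longrightarrow> 0 < r i"
    and diff: "\<And>x. 0 < x \<Longrightarrow> (\<phi> has_field_derivative deriv \<phi> x) (at x)"
  shows "((\<lambda>x. E_QCE \<phi> K N \<nu> (r(k := x))) has_field_derivative
           real (\<nu> k) * (deriv \<phi> (r k) + qce_second K (doubling_force \<phi> r) (bond_force \<phi> r) k))
         (at (r k))"
proof -
  have K: "1 \<le> K" "K + 1 \<le> N" and \<nu>1: "\<And>i. i \<in> {-K-1..K+1} \<Longrightarrow> \<nu> i = 1"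
    using chain by (auto simp: qc_chain_def)
  let ?f = "deriv \<phi> (r k)"
  let ?Q = "deriv \<phi> (2 * r k)"
  let ?B = "bond_force \<phi> r k"
  let ?B' = "bond_force \<phi> r (k-1)"
  let ?e = "real (\<nu> k) * (?f + 2 * ?Q)"
  note [derivative_intros] = DERIV_chain2[OF diff]
  have site: "((\<lambda>x. \<phi> ((r(k := x)) i)) has_field_derivative (if i = k then ?f else 0)) (at (r k))"
    if "i \<in> {-N..N}" for i
    using diff[OF pos[OF k]] by auto
  have bond: "((\<lambda>x. \<phi> ((r(k := x)) i + (r(k := x)) (i+1))) has_field_derivative
                 (if i = k then ?B else 0) + (if i = k-1 then ?B' else 0)) (at (r k))"
    if "i \<in> {-N..<N}" for i
  proof -
    have "0 < r i" "0 < r (i+1)" using that by (auto intro: pos)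
    then show ?thesis
      by (auto intro!: derivative_eq_intros simp: bond_force_def)
  qed
  have element: "((\<lambda>x. element_energy \<phi> N \<nu> (r(k := x)) i) has_field_derivative
                   (if i = k then ?e else 0)) (at (r k))" for i
  proof (cases "i = k")
    case True
    then show ?thesis
      using pos[OF k] k by (auto simp: element_energy_def intro!: derivative_eq_intros)
  qed (simp add: element_energy_def cong: if_cong)
  have continuum: "((\<lambda>x. E_continuum \<phi> N \<nu> (r(k := x)) j) has_field_derivative
        ((if j = k then ?e else 0) + (if j = k+1 then ?e else 0)) / 2) (at (r k))" for j
    unfolding E_continuum_def
    by (rule derivative_eq_intros element refl)+ auto
  have atom: "((\<lambda>x. E_atomistic \<phi> (r(k := x)) j) has_field_derivative
        ((if j = k then ?f + ?B else 0) + (if j = k-1 then ?B' else 0)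
          + (if j = k+1 then ?f + ?B' else 0) + (if j = k+2 then ?B else 0)) / 2) (at (r k))"
    if "j \<in> {-K+1..K}" for j
  proof -
    have idx: "j \<in> {-N..N}" "j \<in> {-N..<N}" "j-1 \<in> {-N..N}" "j-2 \<in> {-N..<N}" using that K by auto
    (* Both bonds of the site energy are written in the form r i + r (i+1), so that one derivative
       rule covers them. *)
    have E: "E_atomistic \<phi> s j = (\<phi> (s j) + \<phi> (s j + s (j+1)) + \<phi> (s (j-1)) + \<phi> (s (j-2) + s (j-2+1))) / 2"
      for s
      by (simp add: E_atomistic_def add.commute)
    have "((\<lambda>x. E_atomistic \<phi> (r(k := x)) j) has_field_derivative
           ((if j = k then ?f else 0) + ((if j = k then ?B else 0) + (if j = k-1 then ?B' else 0))
            + (if j-1 = k then ?f else 0)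
            + ((if j-2 = k then ?B else 0) + (if j-2 = k-1 then ?B' else 0))) / 2) (at (r k))"
      unfolding E using idx by (intro DERIV_cdivide DERIV_add site bond)
    then show ?thesis
      by (rule DERIV_cong) auto
  qed
  have "((\<lambda>x. E_QCE \<phi> K N \<nu> (r(k := x))) has_field_derivative
      (\<Sum>j\<in>{-N..-K}. ((if j = k then ?e else 0) + (if j = k+1 then ?e else 0)) / 2)
      + (\<Sum>j\<in>{-K+1..K}. ((if j = k then ?f + ?B else 0) + (if j = k-1 then ?B' else 0)
          + (if j = k+1 then ?f + ?B' else 0) + (if j = k+2 then ?B else 0)) / 2)
      + (\<Sum>j\<in>{K+1..N+1}. ((if j = k then ?e else 0) + (if j = k+1 then ?e else 0)) / 2)) (at (r k))"
    unfolding E_QCE_def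
    by (intro DERIV_add DERIV_sum continuum atom)
  moreover have "(\<Sum>j\<in>{-N..-K}. ((if j = k then ?e else 0) + (if j = k+1 then ?e else 0)) / 2)
      + (\<Sum>j\<in>{-K+1..K}. ((if j = k then ?f + ?B else 0) + (if j = k-1 then ?B' else 0)
          + (if j = k+1 then ?f + ?B' else 0) + (if j = k+2 then ?B else 0)) / 2)
      + (\<Sum>j\<in>{K+1..N+1}. ((if j = k then ?e else 0) + (if j = k+1 then ?e else 0)) / 2)
    = real (\<nu> k) * (?f + qce_second K (doubling_force \<phi> r) (bond_force \<phi> r) k)"
    unfolding sum_divide_distrib[symmetric] sum.distrib sum.delta[OF finite_atLeastAtMost_int]
  proof (cases rule: chain_position_cases[OF K(1), of k])
  qed (use K k \<nu>1[of k] in \<open>simp_all add: qce_second_def doubling_weight_def bond_weight_def doubling_force_def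
        add_divide_distrib\<close>)
  ultimately show ?thesis by simp
qed

lemma psi_QCE_eq:
  assumes "qc_chain K N \<nu>" "j \<in> {-N..N}"
    and "\<And>i. i \<in> {-N..N} \<Longrightarrow> 0 < r i"
    and "\<And>x. 0 < x \<Longrightarrow> (\<phi> has_field_derivative deriv \<phi> x) (at x)"
  shows "psi_QCE \<phi> K N \<nu> r j =
           - (deriv \<phi> (r j) + qce_second K (doubling_force \<phi> r) (bond_force \<phi> r) j)"
proof -
  have "\<nu> j \<ge> 1" using assms(1,2) by (auto simp: qc_chain_def)
  then show ?thesis
    using DERIV_imp_deriv[OF E_QCE_has_partial_derivative[of K N \<nu> j r \<phi>]] assms
    by (simp add: psi_QCE_def partial_deriv_def)
qed

lemma continuous_on_E_QCE:
  assumes chain: "qc_chain K N \<nu>"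
    and pos: "\<And>r i. r \<in> S \<Longrightarrow> i \<in> {-N..N} \<Longrightarrow> 0 < r i"
    and cont: "continuous_on {0<..} \<phi>"
  shows "continuous_on S (E_QCE \<phi> K N \<nu>)"
proof -
  have K: "1 \<le> K" "K + 1 \<le> N"
    using chain by (auto simp: qc_chain_def)
  have coord: "continuous_on S (\<lambda>r. r i)" for i :: int
    by (rule continuous_on_subset[OF continuous_on_product_coordinates]) simp
  have comp: "continuous_on S (\<lambda>r. \<phi> (f r))"
    if "continuous_on S f" "\<And>r. r \<in> S \<Longrightarrow> 0 < f r" for f
    using that by (auto intro: continuous_on_compose2[OF cont])
  have element: "continuous_on S (\<lambda>r. element_energy \<phi> N \<nu> r i)" for i
  proof (cases "i \<in> {-N..N}")
    case True
    then show ?thesis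
      using pos
      by (simp add: element_energy_def)
         (intro continuous_on_mult_left continuous_on_add comp coord continuous_intros, auto)
  qed (simp add: element_energy_def del: atLeastAtMost_iff)
  have atom: "continuous_on S (\<lambda>r. E_atomistic \<phi> r j)" if "j \<in> {-K+1..K}" for j
    unfolding E_atomistic_def using that K
    by (intro continuous_intros comp coord add_pos_pos pos) auto
  show ?thesis
    unfolding E_QCE_def E_continuum_def
    by (intro continuous_intros element atom) auto
qed

section \<open>One step of the iteration\<close>

lemma abs_le_max_norm:
  assumes "j \<in> {-N..N}"
  shows "\<bar>x j\<bar> \<le> max_norm N x"
  unfolding max_norm_def using assms by (intro Max_ge) auto

lemma max_norm_attained:
  assumes "0 \<le> N"
  obtains j where "j \<in> {-N..N}" "max_norm N x = \<bar>x j\<bar>"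
proof -
  have "max_norm N x \<in> (\<lambda>j. \<bar>x j\<bar>) ` {-N..N}"
    unfolding max_norm_def using assms by (intro Max_in) auto
  then show ?thesis using that by auto
qed

text \<open>
  What the analysis of one step needs of the potential: \<open>\<phi>'\<close> has slope at least \<open>A\<close> at nearest-neighbour
  distances, and decreases with slope at most \<open>b\<close> in absolute value at second-neighbour distances.
\<close>

locale qc_box =
  fixes \<phi> :: "real \<Rightarrow> real" and K N :: int and \<nu> :: "int \<Rightarrow> nat" and rL rU A b :: real
  assumes chain: "qc_chain K N \<nu>"
    and box: "0 < rL" "rL < rU"
    and diff: "\<And>x. 0 < x \<Longrightarrow> (\<phi> has_field_derivative deriv \<phi> x) (at x)"
    and nearest_stiff: "\<And>x y. rL \<le> x \<Longrightarrow> x \<le> y \<Longrightarrow> y \<le> rU \<Longrightarrow> A * (y - x) \<le> deriv \<phi> y - deriv \<phi> x"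
    and second_antimono: "\<And>x y. 2 * rL \<le> x \<Longrightarrow> x \<le> y \<Longrightarrow> y \<le> 2 * rU \<Longrightarrow> deriv \<phi> y \<le> deriv \<phi> x"
    and second_soft: "\<And>x y. 2 * rL \<le> x \<Longrightarrow> x \<le> y \<Longrightarrow> y \<le> 2 * rU \<Longrightarrow>
                        deriv \<phi> x - deriv \<phi> y \<le> b * (y - x)"
    and b_nonneg: "0 \<le> b" and dominant: "21 * b < A"
begin

lemma K: "1 \<le> K" "K + 1 \<le> N"
  using chain by (auto simp: qc_chain_def)

abbreviation "closed_box \<equiv> {r. \<forall>i\<in>{-N..N}. r i \<in> {rL..rU}}"

lemma cube_subset_closed_box: "cube N rL rU \<subseteq> closed_box"
proof -
  have "r i \<in> {rL<..<rU}" if "r \<in> cube N rL rU" "i \<in> {-N..N}" for r i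
    using that unfolding cube_def by (rule PiE_mem)
  then show ?thesis by force
qed

lemma ghost_force_step_iff:
  assumes "r \<in> closed_box" "r' \<in> closed_box"
  shows "ghost_force_step \<phi> K N \<nu> \<Phi> r r' \<longleftrightarrow>
    (\<forall>j\<in>{-N..N}. deriv \<phi> (r' j) + qce_second K (doubling_force \<phi> r') (bond_force \<phi> r') j
        + ghost_second K (doubling_force \<phi> r) (bond_force \<phi> r) j = \<Phi> j)"
proof -
  have "0 < r i" "0 < r' i" if "i \<in> {-N..N}" for i
    using assms that box by force+
  note pos = this
  have "psi_QCE \<phi> K N \<nu> r j =
        - (deriv \<phi> (r j) + qce_second K (doubling_force \<phi> r) (bond_force \<phi> r) j)"
      "psi_QCE \<phi> K N \<nu> r' j =
        - (deriv \<phi> (r' j) + qce_second K (doubling_force \<phi> r') (bond_force \<phi> r') j)"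
    if "j \<in> {-N..N}" for j
    using psi_QCE_eq[OF chain that _ diff, of r] psi_QCE_eq[OF chain that _ diff, of r']
    by (blast intro: pos)+
  then show ?thesis
    unfolding ghost_force_step_def
    by (intro ball_cong refl) (auto simp: psi_G_def psi_QCF_eq ghost_second_def)
qed

lemma second_forces_in_range:
  assumes "r \<in> closed_box"
  shows "i \<in> {-N..N} \<Longrightarrow> doubling_force \<phi> r i \<in> {deriv \<phi> (2 * rU)..deriv \<phi> (2 * rL)}"
    and "i \<in> {-N..<N} \<Longrightarrow> bond_force \<phi> r i \<in> {deriv \<phi> (2 * rU)..deriv \<phi> (2 * rL)}"
proof -
  have range: "deriv \<phi> x \<in> {deriv \<phi> (2 * rU)..deriv \<phi> (2 * rL)}" if "x \<in> {2 * rL..2 * rU}" for x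
    using that second_antimono[of "2 * rL" x] second_antimono[of x "2 * rU"] by auto
  show "i \<in> {-N..N} \<Longrightarrow> doubling_force \<phi> r i \<in> {deriv \<phi> (2 * rU)..deriv \<phi> (2 * rL)}"
    unfolding doubling_force_def using assms by (intro range) auto
  assume "i \<in> {-N..<N}"
  then have "r i \<in> {rL..rU}" "r (i+1) \<in> {rL..rU}" using assms by auto
  then show "bond_force \<phi> r i \<in> {deriv \<phi> (2 * rU)..deriv \<phi> (2 * rL)}"
    unfolding bond_force_def by (intro range) auto
qed

lemma second_forces_lipschitz:
  assumes r: "r \<in> closed_box" and s: "s \<in> closed_box"
  shows "i \<in> {-N..N} \<Longrightarrow>
      \<bar>doubling_force \<phi> r i - doubling_force \<phi> s i\<bar> \<le> 2 * b * max_norm N (\<lambda>j. r j - s j)"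
    and "i \<in> {-N..<N} \<Longrightarrow>
      \<bar>bond_force \<phi> r i - bond_force \<phi> s i\<bar> \<le> 2 * b * max_norm N (\<lambda>j. r j - s j)"
proof -
  let ?M = "max_norm N (\<lambda>j. r j - s j)"
  have lip: "\<bar>deriv \<phi> x - deriv \<phi> y\<bar> \<le> 2 * b * ?M"
    if "x \<in> {2 * rL..2 * rU}" "y \<in> {2 * rL..2 * rU}" "\<bar>x - y\<bar> \<le> 2 * ?M" for x y
  proof -
    have "\<bar>deriv \<phi> x - deriv \<phi> y\<bar> \<le> b * \<bar>x - y\<bar>"
      using that second_soft[of x y] second_antimono[of x y]
        second_soft[of y x] second_antimono[of y x]
      by (cases "x \<le> y") auto
    also have "\<dots> \<le> b * (2 * ?M)"
      using that b_nonneg by (intro mult_left_mono)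
    finally show ?thesis by (simp add: mult_ac)
  qed
  have M: "\<bar>r i - s i\<bar> \<le> ?M" if "i \<in> {-N..N}" for i
    using abs_le_max_norm[OF that] .
  show "\<bar>doubling_force \<phi> r i - doubling_force \<phi> s i\<bar> \<le> 2 * b * ?M" if "i \<in> {-N..N}"
    unfolding doubling_force_def using r s that M[OF that] by (intro lip) auto
  assume i: "i \<in> {-N..<N}"
  then have "r i \<in> {rL..rU}" "r (i+1) \<in> {rL..rU}" "s i \<in> {rL..rU}" "s (i+1) \<in> {rL..rU}"
    using r s by auto
  moreover have "\<bar>r i - s i\<bar> \<le> ?M" "\<bar>r (i+1) - s (i+1)\<bar> \<le> ?M" using i by (auto intro!: M)
  ultimately show "\<bar>bond_force \<phi> r i - bond_force \<phi> s i\<bar> \<le> 2 * b * ?M"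
    unfolding bond_force_def by (intro lip) auto
qed

text \<open>
  Diagonal dominance in the maximum norm: at an element where \<open>\<bar>r'\<^sub>j - s'\<^sub>j\<bar>\<close> is largest, the
  nearest-neighbour force changes by at least \<open>A\<close> times the norm of \<open>r' - s'\<close>. The balance of forces
  lets only second-neighbour forces compensate this.
\<close>

lemma ghost_force_step_estimate:
  assumes r: "r \<in> closed_box" and s: "s \<in> closed_box"
    and r': "r' \<in> closed_box" and s': "s' \<in> closed_box"
    and steps: "ghost_force_step \<phi> K N \<nu> \<Phi> r r'" "ghost_force_step \<phi> K N \<nu> \<Phi> s s'"
  shows "(A - 5 * b) * max_norm N (\<lambda>j. r' j - s' j) \<le> 16 * b * max_norm N (\<lambda>j. r j - s j)"
proof -
  let ?M = "max_norm N (\<lambda>j. r j - s j)"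
  let ?M' = "max_norm N (\<lambda>j. r' j - s' j)"
  obtain j where j: "j \<in> {-N..N}" and M': "?M' = \<bar>r' j - s' j\<bar>"
    using max_norm_attained[of N "\<lambda>j. r' j - s' j"] K by auto
  let ?P = "qce_second K (doubling_force \<phi> r') (bond_force \<phi> r') j
          - qce_second K (doubling_force \<phi> s') (bond_force \<phi> s') j"
  let ?G = "ghost_second K (doubling_force \<phi> r) (bond_force \<phi> r) j
          - ghost_second K (doubling_force \<phi> s) (bond_force \<phi> s) j"
  have balance: "deriv \<phi> (r' j) - deriv \<phi> (s' j) + ?P + ?G = 0"
    using bspec[OF iffD1[OF ghost_force_step_iff[OF r r'] steps(1)] j]
      bspec[OF iffD1[OF ghost_force_step_iff[OF s s'] steps(2)] j] by linarith
  have P: "\<bar>?P\<bar> \<le> 5/2 * (2 * b * ?M')"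
    unfolding qce_second_diff
    by (rule qce_second_abs_le[OF K j]) (auto intro!: second_forces_lipschitz[OF r' s', simplified])
  have G: "\<bar>?G\<bar> \<le> 8 * (2 * b * ?M)"
    unfolding ghost_second_diff
    by (rule ghost_second_abs_le[OF K j]) (auto intro!: second_forces_lipschitz[OF r s, simplified])
  have "r' j \<in> {rL..rU}" "s' j \<in> {rL..rU}" using r' s' j by auto
  then have "A * \<bar>r' j - s' j\<bar> \<le> \<bar>deriv \<phi> (r' j) - deriv \<phi> (s' j)\<bar>"
    using nearest_stiff[of "r' j" "s' j"] nearest_stiff[of "s' j" "r' j"]
    by (cases "r' j \<le> s' j") auto
  then have "A * ?M' \<le> \<bar>?P\<bar> + \<bar>?G\<bar>"
    unfolding M' using balance by linarith
  then show ?thesis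
    using P G by (simp add: algebra_simps)
qed

text \<open>
  The variational argument: for fixed \<open>r\<close> the step equations are the Euler-Lagrange equations of the
  QCE energy with a linear load, and the bounds on \<open>\<Phi>\<close> give the signs of the derivative on the
  faces of the box.
\<close>

lemma ghost_force_step_exists:
  assumes r: "r \<in> closed_box"
    and lower: "\<And>j. j \<in> {-N..N} \<Longrightarrow>
           deriv \<phi> rL + 6 * deriv \<phi> (2 * rL) - 4 * deriv \<phi> (2 * rU) < \<Phi> j"
    and upper: "\<And>j. j \<in> {-N..N} \<Longrightarrow>
           \<Phi> j < deriv \<phi> rU + 6 * deriv \<phi> (2 * rU) - 4 * deriv \<phi> (2 * rL)"
  shows "\<exists>r' \<in> cube N rL rU. ghost_force_step \<phi> K N \<nu> \<Phi> r r'"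
proof -
  let ?box = "PiE {-N..N} (\<lambda>_. {rL..rU})"
  let ?G = "\<lambda>j. ghost_second K (doubling_force \<phi> r) (bond_force \<phi> r) j"
  let ?P = "\<lambda>s j. qce_second K (doubling_force \<phi> s) (bond_force \<phi> s) j"
  let ?E = "\<lambda>s. E_QCE \<phi> K N \<nu> s + (\<Sum>j\<in>{-N..N}. real (\<nu> j) * (?G j - \<Phi> j) * s j)"
  let ?D = "\<lambda>s j. real (\<nu> j) * (deriv \<phi> (s j) + ?P s j + ?G j - \<Phi> j)"
  have \<nu>: "0 < real (\<nu> j)" if "j \<in> {-N..N}" for j
    using chain that by (force simp: qc_chain_def)
  have closed: "s \<in> closed_box" if "s \<in> ?box" for s
    using that by auto
  have pos: "0 < s i" if "s \<in> ?box" "i \<in> {-N..N}" for s i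
    using PiE_mem[OF that] box by auto
  have second: "?P s j + ?G j \<in> {6 * deriv \<phi> (2 * rU) - 4 * deriv \<phi> (2 * rL)
                                    ..6 * deriv \<phi> (2 * rL) - 4 * deriv \<phi> (2 * rU)}"
    if "s \<in> ?box" "j \<in> {-N..N}" for s j
    by (rule mixed_second_bounds[OF K that(2)])
       (use second_forces_in_range[OF r] second_forces_in_range[OF closed[OF that(1)]] in blast)+
  have "\<exists>s \<in> PiE {-N..N} (\<lambda>_. {rL<..<rU}). \<forall>j\<in>{-N..N}. ?D s j = 0"
  proof (rule critical_point_in_open_box[OF box(2)])
    have coord: "continuous_on ?box (\<lambda>s. s i)" for i :: int
      by (rule continuous_on_subset[OF continuous_on_product_coordinates]) simp
    have "continuous_on {0<..} \<phi>"
      using diff by (auto intro!: continuous_at_imp_continuous_on DERIV_isCont)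
    then have "continuous_on ?box (E_QCE \<phi> K N \<nu>)"
      using pos by (intro continuous_on_E_QCE[OF chain]) blast+
    then show "continuous_on ?box ?E"
      by (intro continuous_intros coord)
  next
    fix s j assume s: "s \<in> ?box" and j: "j \<in> {-N..N}"
    have lin: "((\<lambda>x. \<Sum>i\<in>{-N..N}. real (\<nu> i) * (?G i - \<Phi> i) * (s(j := x)) i) has_field_derivative
            (\<Sum>i\<in>{-N..N}. if i = j then real (\<nu> j) * (?G j - \<Phi> j) else 0)) (at (s j))"
      by (intro DERIV_sum) (auto intro!: derivative_eq_intros)
    have "((\<lambda>x. ?E (s(j := x))) has_field_derivative
        real (\<nu> j) * (deriv \<phi> (s j) + ?P s j)
        + (\<Sum>i\<in>{-N..N}. if i = j then real (\<nu> j) * (?G j - \<Phi> j) else 0)) (at (s j))"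
      by (intro DERIV_add lin E_QCE_has_partial_derivative[OF chain j] diff pos[OF s])
    then show "((\<lambda>x. ?E (s(j := x))) has_field_derivative ?D s j) (at (s j))"
      by (rule DERIV_cong) (use j in \<open>simp add: algebra_simps\<close>)
    show "?D s j < 0" if "s j = rL"
      using second[OF s j] lower[OF j] \<nu>[OF j] that by (intro mult_pos_neg) auto
    show "?D s j > 0" if "s j = rU"
      using second[OF s j] upper[OF j] \<nu>[OF j] that by (intro mult_pos_pos) auto
  qed
  then obtain s where s: "s \<in> cube N rL rU" and crit: "\<forall>j\<in>{-N..N}. ?D s j = 0"
    unfolding cube_def by blast
  have "ghost_force_step \<phi> K N \<nu> \<Phi> r s"
    unfolding ghost_force_step_iff[OF r subsetD[OF cube_subset_closed_box s]]
    using crit \<nu> by force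
  then show ?thesis using s by blast
qed

lemma ghost_force_step_unique:
  assumes r: "r \<in> closed_box" and "r' \<in> cube N rL rU" "s' \<in> cube N rL rU"
    and "ghost_force_step \<phi> K N \<nu> \<Phi> r r'" "ghost_force_step \<phi> K N \<nu> \<Phi> r s'"
  shows "r' = s'"
proof -
  have "(A - 5 * b) * max_norm N (\<lambda>j. r' j - s' j) \<le> 16 * b * max_norm N (\<lambda>j. r j - r j)"
    using assms cube_subset_closed_box by (intro ghost_force_step_estimate) auto
  also have "max_norm N (\<lambda>j. r j - r j) = 0"
    using max_norm_attained[of N "\<lambda>j. r j - r j"] K by auto
  finally have "max_norm N (\<lambda>j. r' j - s' j) \<le> 0"
    using dominant b_nonneg by (simp add: mult_le_0_iff)
  then have "r' j = s' j" if "j \<in> {-N..N}" for j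
    using abs_le_max_norm[OF that, of "\<lambda>j. r' j - s' j"] by simp
  then show ?thesis
    using assms(2,3) unfolding cube_def by (intro PiE_ext) auto
qed

end

section \<open>The ghost force iteration is a contraction\<close>

lemma Ck_on_open_3_derivatives:
  assumes "Ck_on_open 3 f {0<..}" and "(0::real) < x"
  shows "(f has_field_derivative deriv f x) (at x)"
    and "(deriv f has_field_derivative (deriv ^^ 2) f x) (at x)"
    and "((deriv ^^ 2) f has_field_derivative (deriv ^^ 3) f x) (at x)"
proof -
  have "((deriv ^^ i) f has_field_derivative (deriv ^^ Suc i) f x) (at x)" if "i < 3" for i
  proof -
    have "(deriv ^^ i) f differentiable (at x)"
      using assms that by (auto simp: Ck_on_open_def differentiable_on_eq_differentiable_at)
    then show ?thesis
      by (simp add: DERIV_deriv_iff_real_differentiable)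
  qed
  from this[of 0] this[of 1] this[of 2] show
    "(f has_field_derivative deriv f x) (at x)"
    "(deriv f has_field_derivative (deriv ^^ 2) f x) (at x)"
    "((deriv ^^ 2) f has_field_derivative (deriv ^^ 3) f x) (at x)"
    by (simp_all add: numeral_2_eq_2 numeral_3_eq_3)
qed

text \<open>
  Since \<open>2 r\<^sub>L\<close> exceeds both inflection points, \<open>\<phi>''(2 r\<^sub>L) < 0\<close> and \<open>\<phi>''\<close> increases towards \<open>0\<close> from there on,
  so its absolute value is largest at \<open>2 r\<^sub>L\<close>. The stiffness hypothesis then forces \<open>\<phi>''(r\<^sub>U) > 0\<close>, hence
  \<open>r\<^sub>U \<le> rt1\<close>, so \<open>\<phi>''\<close> decreases on \<open>[r\<^sub>L, r\<^sub>U]\<close> and is smallest at \<open>r\<^sub>U\<close>.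
\<close>

lemma qc_box_of_potential:
  assumes pot: "qc_potential \<phi> a0 rt1 rt2 Dt"
    and chain: "qc_chain K N \<nu>"
    and rL: "rt2 / 2 < rL" and "rL < rU"
    and stiff: "(deriv ^^ 2) \<phi> rU + 21 * (deriv ^^ 2) \<phi> (2 * rL) > 0"
  shows "qc_box \<phi> K N \<nu> rL rU ((deriv ^^ 2) \<phi> rU) \<bar>(deriv ^^ 2) \<phi> (2 * rL)\<bar>"
proof -
  let ?d2 = "(deriv ^^ 2) \<phi>"
  have rt: "0 < rt1" "rt1 < rt2" and C3: "Ck_on_open 3 \<phi> {0<..}"
    and neg2: "\<And>r. r > rt1 \<Longrightarrow> ?d2 r < 0"
    and neg3: "\<And>r. 0 < r \<Longrightarrow> r < rt2 \<Longrightarrow> (deriv ^^ 3) \<phi> r < 0"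
    and pos3: "\<And>r. r > rt2 \<Longrightarrow> (deriv ^^ 3) \<phi> r > 0"
    using pot by (auto simp: qc_potential_def)
  note d = Ck_on_open_3_derivatives[OF C3]
  have pos: "0 < rL" "rt2 < 2 * rL" using rt rL by auto
  have b: "?d2 (2 * rL) < 0" using neg2 pos rt by simp
  then have rU: "rU \<le> rt1" using neg2[of rU] stiff by force
  have stiffness: "?d2 rU \<le> ?d2 x" if "rL \<le> x" "x \<le> rU" for x
  proof (rule DERIV_nonpos_imp_nonincreasing[OF that(2)])
    fix t assume "x \<le> t" "t \<le> rU"
    then have "0 < t" "t < rt2" using that pos rU rt by auto
    then show "\<exists>y. DERIV ?d2 t :> y \<and> y \<le> 0" using d(3) neg3 less_imp_le by blast
  qed
  have softness: "?d2 (2 * rL) \<le> ?d2 x" "?d2 x \<le> 0" if "2 * rL \<le> x" for x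
  proof (rule DERIV_nonneg_imp_nondecreasing[OF that])
    fix t assume "2 * rL \<le> t" "t \<le> x"
    then have "0 < t" "rt2 < t" using pos by auto
    then show "\<exists>y. DERIV ?d2 t :> y \<and> 0 \<le> y" using d(3) pos3 less_imp_le by blast
  qed (use neg2[of x] that pos rt in simp)
  have mvt: "\<exists>z. x \<le> z \<and> z \<le> y \<and> deriv \<phi> y - deriv \<phi> x = (y - x) * ?d2 z"
    if "0 < x" "x \<le> y" for x y
  proof (cases "x = y")
    case False
    then have "x < y" using that by simp
    then have "\<exists>z. x < z \<and> z < y \<and> deriv \<phi> y - deriv \<phi> x = (y - x) * ?d2 z"
      by (rule MVT2) (use that d(2) in auto)
    then show ?thesis by (meson less_imp_le)
  qed auto
  show ?thesis
  proof
    show "?d2 rU * (y - x) \<le> deriv \<phi> y - deriv \<phi> x" if "rL \<le> x" "x \<le> y" "y \<le> rU" for x y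
    proof -
      have "0 < x" using that(1) pos by simp
      from mvt[OF this that(2)] obtain z where "x \<le> z" "z \<le> y" "deriv \<phi> y - deriv \<phi> x = (y - x) * ?d2 z"
        by blast
      then show ?thesis
        using stiffness[of z] that by (simp add: mult.commute mult_left_mono)
    qed
    fix x y assume xy: "2 * rL \<le> x" "x \<le> y"
    have "0 < x" using xy(1) pos by simp
    from mvt[OF this xy(2)] obtain z where z: "x \<le> z" "z \<le> y" "deriv \<phi> y - deriv \<phi> x = (y - x) * ?d2 z"
      by blast
    show "deriv \<phi> y \<le> deriv \<phi> x"
      using z softness(2)[of z] xy mult_nonneg_nonpos[of "y - x" "?d2 z"] by simp
    have "(y - x) * ?d2 (2 * rL) \<le> (y - x) * ?d2 z"
      using z softness(1)[of z] xy by (intro mult_left_mono) auto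
    then show "deriv \<phi> x - deriv \<phi> y \<le> \<bar>?d2 (2 * rL)\<bar> * (y - x)"
      using z b by (simp add: algebra_simps)
  qed (use assms pos b d(1) in auto)
qed

theorem theorem3p1:
  fixes \<phi> :: "real \<Rightarrow> real" and a0 rt1 rt2 Dt rL rU :: real
    and K N :: int and \<nu> :: "int \<Rightarrow> nat" and \<Phi> :: "int \<Rightarrow> real"
  assumes "qc_potential \<phi> a0 rt1 rt2 Dt"
    and "qc_chain K N \<nu>"
    and "rt2 / 2 < rL" and "rL < rU"
    and "(deriv ^^ 2) \<phi> rU + 21 * (deriv ^^ 2) \<phi> (2 * rL) > 0"
    and "\<And>j. j \<in> {-N..N} \<Longrightarrow>
           deriv \<phi> rL + 6 * deriv \<phi> (2 * rL) - 4 * deriv \<phi> (2 * rU) < \<Phi> j"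
    and "\<And>j. j \<in> {-N..N} \<Longrightarrow>
           \<Phi> j < deriv \<phi> rU + 6 * deriv \<phi> (2 * rU) - 4 * deriv \<phi> (2 * rL)"
  shows "(\<forall>r \<in> cube N rL rU. \<exists>!r'. r' \<in> cube N rL rU \<and> ghost_force_step \<phi> K N \<nu> \<Phi> r r') \<and>
    (\<forall>r \<in> cube N rL rU. \<forall>s \<in> cube N rL rU. \<forall>r' \<in> cube N rL rU. \<forall>s' \<in> cube N rL rU.
       ghost_force_step \<phi> K N \<nu> \<Phi> r r' \<and> ghost_force_step \<phi> K N \<nu> \<Phi> s s' \<longrightarrow>
       max_norm N (\<lambda>j. r' j - s' j)
         \<le> 16 * \<bar>(deriv ^^ 2) \<phi> (2 * rL)\<bar> / ((deriv ^^ 2) \<phi> rU - 5 * \<bar>(deriv ^^ 2) \<phi> (2 * rL)\<bar>)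
            * max_norm N (\<lambda>j. r j - s j)) \<and>
    16 * \<bar>(deriv ^^ 2) \<phi> (2 * rL)\<bar> / ((deriv ^^ 2) \<phi> rU - 5 * \<bar>(deriv ^^ 2) \<phi> (2 * rL)\<bar>) < 1"
proof -
  let ?A = "(deriv ^^ 2) \<phi> rU"
  let ?b = "\<bar>(deriv ^^ 2) \<phi> (2 * rL)\<bar>"
  interpret qc_box \<phi> K N \<nu> rL rU ?A ?b
    by (rule qc_box_of_potential) fact+
  note closed = subsetD[OF cube_subset_closed_box]
  have gap: "0 < ?A - 5 * ?b" using dominant b_nonneg by linarith
  have "\<exists>!r'. r' \<in> cube N rL rU \<and> ghost_force_step \<phi> K N \<nu> \<Phi> r r'" if "r \<in> cube N rL rU" for r
    using ghost_force_step_exists[OF closed[OF that], of \<Phi>] assms(6,7)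
      ghost_force_step_unique[OF closed[OF that]] by blast
  moreover have "max_norm N (\<lambda>j. r' j - s' j) \<le> 16 * ?b / (?A - 5 * ?b) * max_norm N (\<lambda>j. r j - s j)"
    if "r \<in> cube N rL rU" "s \<in> cube N rL rU" "r' \<in> cube N rL rU" "s' \<in> cube N rL rU"
      "ghost_force_step \<phi> K N \<nu> \<Phi> r r'" "ghost_force_step \<phi> K N \<nu> \<Phi> s s'" for r s r' s'
    using ghost_force_step_estimate[OF closed closed closed closed, OF that] gap
    by (simp add: pos_le_divide_eq mult.commute)
  moreover have "16 * ?b / (?A - 5 * ?b) < 1"
    using dominant gap by (simp add: pos_divide_less_eq)
  ultimately show ?thesis by blast
qed

end
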